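(* Let $-\infty<a<b<+\infty$, let $f:[a;b]\rightarrow\mathbb{R}$ be a càdlàg function and let $c>0$. Then $$\inf_{\|g-f\|_{\infty}\leq c/2}TV\left(g,[a;b]\right)=TV^{c}\left(f,[a;b]\right),$$ where the infimum is over all functions $g:[a;b]\rightarrow\mathbb{R}$ with $\|g-f\|_\infty\leq c/2$. Moreover, there exists a càdlàg function $f^{c}:[a;b]\rightarrow\mathbb{R}$ such that $$\|f^{c}-f\|_{\infty}\leq c/2\quad\text{and}\quad TV\left(f^{c},[a;b]\right)=TV^{c}\left(f,[a;b]\right).$$
   Context: A càdlàg function is a right-continuous function with left limits. For $h:[a;b]\rightarrow\mathbb{R}$, $\|h\|_\infty=\sup_{t\in[a;b]}|h(t)|$. The total variation of $g:[a;b]\to\mathbb{R}$ is $$TV(g,[a;b])=\sup_{n}\sup_{a\leq t_0<t_1<\ldots<t_n\leq b}\sum_{i=1}^{n}|g(t_i)-g(t_{i-1})|\in[0;+\infty],$$ and the truncated variation of $f$ at the level $c$ is $$TV^{c}(f,[a;b])=\sup_{n}\sup_{a\leq t_0<t_1<\ldots<t_n\leq b}\sum_{i=1}^{n}\max\left\{|f(t_i)-f(t_{i-1})|-c,0\right\}.$$ *)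

theory Defs
  imports "HOL-Analysis.Analysis"
begin

text \<open>A function \<open>[a;b] \<rightarrow> \<real>\<close> is represented by a function \<open>real \<Rightarrow> real\<close>; no definition below
  depends on its values outside \<open>{a..b}\<close>.\<close>

definition cadlag_on :: "real \<Rightarrow> real \<Rightarrow> (real \<Rightarrow> real) \<Rightarrow> bool" where
  "cadlag_on a b f \<longleftrightarrow>
     (\<forall>t\<in>{a..<b}. (f \<longlongrightarrow> f t) (at_right t)) \<and>
     (\<forall>t\<in>{a<..b}. \<exists>l. (f \<longlongrightarrow> l) (at_left t))"

text \<open>The supremum is taken in \<^typ>\<open>ennreal\<close>, so that it is \<open>\<infinity>\<close> for unbounded functions.\<close>

definition sup_norm_on :: "real \<Rightarrow> real \<Rightarrow> (real \<Rightarrow> real) \<Rightarrow> ennreal" where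
  "sup_norm_on a b h = (SUP t\<in>{a..b}. ennreal \<bar>h t\<bar>)"

text \<open>The points \<open>a \<le> t\<^sub>0 < \<dots> < t\<^sub>n \<le> b\<close>; the values \<open>t i\<close> for \<open>i > n\<close> are irrelevant.
  For \<open>n = 0\<close> the sums below are empty, which does not change the suprema.\<close>

definition subdivisions :: "real \<Rightarrow> real \<Rightarrow> nat \<Rightarrow> (nat \<Rightarrow> real) set" where
  "subdivisions a b n = {t. a \<le> t 0 \<and> strict_mono_on {0..n} t \<and> t n \<le> b}"

definition total_variation :: "real \<Rightarrow> real \<Rightarrow> (real \<Rightarrow> real) \<Rightarrow> ennreal" where
  "total_variation a b g =
     (SUP n. SUP t\<in>subdivisions a b n. ennreal (\<Sum>i=1..n. \<bar>g (t i) - g (t (i - 1))\<bar>))"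

definition truncated_variation :: "real \<Rightarrow> real \<Rightarrow> real \<Rightarrow> (real \<Rightarrow> real) \<Rightarrow> ennreal" where
  "truncated_variation c a b f =
     (SUP n. SUP t\<in>subdivisions a b n.
        ennreal (\<Sum>i=1..n. max (\<bar>f (t i) - f (t (i - 1))\<bar> - c) 0))"

end

theory Submission
  imports Defs
begin

text \<open>With \<open>T t\<close> the truncated variation of \<open>f\<close> on \<open>[a;t]\<close>, superadditivity gives
  \<open>\<bar>f t - f s\<bar> - c \<le> T t - T s\<close> for \<open>s \<le> t\<close>. This survives the passage to the right-continuous
  version \<open>S\<close> of \<open>T\<close>, and says that the intervals \<open>[f t - c/2; f t + c/2]\<close> are pairwise at distance
  at most \<open>\<bar>S t - S s\<bar>\<close>. Hence the McShane-type formula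
  \<open>g t = (SUP s. f s - c/2 - \<bar>S t - S s\<bar>)\<close> selects a point of each interval and is 1-Lipschitz with
  respect to \<open>S\<close>, so that \<open>g\<close> is cadlag with variation at most \<open>S b = T b\<close>. If \<open>T b\<close> is
  infinite, \<open>f\<close> itself does the job.\<close>

section \<open>Subdivisions and the lower bound for the total variation of nearby functions\<close>

lemma ennreal_sum_le_total_variation:
  assumes "t \<in> subdivisions a b n"
  shows "ennreal (\<Sum>i=1..n. \<bar>g (t i) - g (t (i - 1))\<bar>) \<le> total_variation a b g"
  unfolding total_variation_def using assms by (intro SUP_upper2[of n] SUP_upper) auto

lemma ennreal_sum_le_truncated_variation:
  assumes "t \<in> subdivisions a b n"
  shows "ennreal (\<Sum>i=1..n. max (\<bar>f (t i) - f (t (i - 1))\<bar> - c) 0) \<le> truncated_variation c a b f"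
  unfolding truncated_variation_def using assms by (intro SUP_upper2[of n] SUP_upper) auto

lemma subdivisions_bounds:
  assumes "t \<in> subdivisions a b n" and "i \<le> n"
  shows "t i \<in> {a..b}"
proof -
  have "t 0 \<le> t i" "t i \<le> t n"
    using assms strict_mono_on_leD[of "{0..n}" t] by (auto simp: subdivisions_def)
  then show ?thesis using assms by (auto simp: subdivisions_def)
qed

lemma subdivisions_less:
  assumes "t \<in> subdivisions a b n" and "i \<in> {1..n}"
  shows "t (i - 1) < t i"
  using assms by (auto simp: subdivisions_def strict_mono_on_def)

lemma sup_norm_on_le_iff:
  assumes "0 \<le> r"
  shows "sup_norm_on a b h \<le> ennreal r \<longleftrightarrow> (\<forall>t\<in>{a..b}. \<bar>h t\<bar> \<le> r)"
  using assms by (auto simp: sup_norm_on_def SUP_le_iff ennreal_le_iff)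

text \<open>Moving both endpoints of an increment by at most \<open>c / 2\<close> changes it by at
  most \<open>c\<close>, so the inequality holds term by term. It is the lower bound for the
  infimum.\<close>

lemma truncated_variation_le_total_variation:
  assumes "0 \<le> c" and near: "\<And>t. t \<in> {a..b} \<Longrightarrow> \<bar>g t - f t\<bar> \<le> c / 2"
  shows "truncated_variation c a b f \<le> total_variation a b g"
  unfolding truncated_variation_def
proof (intro SUP_least)
  fix n t assume t: "t \<in> subdivisions a b n"
  have "(\<Sum>i=1..n. max (\<bar>f (t i) - f (t (i - 1))\<bar> - c) 0) \<le> (\<Sum>i=1..n. \<bar>g (t i) - g (t (i - 1))\<bar>)"
  proof (rule sum_mono)
    fix i assume "i \<in> {1..n}"
    then have "t i \<in> {a..b}" "t (i - 1) \<in> {a..b}"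
      using subdivisions_bounds[OF t, of i] subdivisions_bounds[OF t, of "i - 1"] by auto
    then have "\<bar>g (t i) - f (t i)\<bar> \<le> c / 2" "\<bar>g (t (i - 1)) - f (t (i - 1))\<bar> \<le> c / 2"
      by (blast intro: near)+
    then show "max (\<bar>f (t i) - f (t (i - 1))\<bar> - c) 0 \<le> \<bar>g (t i) - g (t (i - 1))\<bar>"
      by linarith
  qed
  then show "ennreal (\<Sum>i=1..n. max (\<bar>f (t i) - f (t (i - 1))\<bar> - c) 0) \<le> total_variation a b g"
    using ennreal_sum_le_total_variation[OF t, of g] ennreal_leI order_trans by blast
qed

section \<open>Superadditivity and monotonicity of the truncated variation in the right
  endpoint\<close>

lemma subdivisions_append:
  assumes "t \<in> subdivisions a b n" and "t n < u" and "u \<le> v"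
  shows "t(Suc n := u) \<in> subdivisions a v (Suc n)"
proof -
  have "strict_mono_on {0..Suc n} (t(Suc n := u))"
  proof (rule strict_mono_onI)
    fix i j assume ij: "i \<in> {0..Suc n}" "j \<in> {0..Suc n}" "i < j"
    have mono: "k < l \<Longrightarrow> l \<le> n \<Longrightarrow> t k < t l" for k l
      using assms(1) by (auto simp: subdivisions_def strict_mono_on_def)
    have "i \<le> n" using ij by auto
    then have "t i \<le> t n" using mono[of i n] by (cases "i = n") auto
    then show "(t(Suc n := u)) i < (t(Suc n := u)) j"
      using mono[of i j] ij assms(2) by auto
  qed
  then show ?thesis using assms by (auto simp: subdivisions_def)
qed

text \<open>A subdivision of \<open>{a..u}\<close> that ends at \<open>u\<close> can be prolonged by
  \<open>v\<close>, which adds exactly the last summand; any other one is first made to end at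
  \<open>u\<close>.\<close>

lemma truncated_variation_superadditive:
  assumes "0 \<le> c" and "a \<le> u" and "u \<le> v"
  shows "truncated_variation c a u f + ennreal (max (\<bar>f v - f u\<bar> - c) 0) \<le> truncated_variation c a v f"
proof (cases "u = v")
  case True
  then show ?thesis using \<open>0 \<le> c\<close> by simp
next
  case False
  let ?j = "\<lambda>x y. max (\<bar>f x - f y\<bar> - c) 0"
  let ?V = "\<lambda>t n. \<Sum>i=1..n. ?j (t i) (t (i - 1))"
  have app: "?V (t(Suc n := w)) (Suc n) = ?V t n + ?j w (t n)" for t n w
  proof -
    have "?V (t(Suc n := w)) n = ?V t n"
      by (intro sum.cong) auto
    then show ?thesis by simp
  qed
  have at_u: "ennreal (?V t n) + ennreal (?j v u) \<le> truncated_variation c a v f"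
    if "t \<in> subdivisions a u n" "t n = u" for t n
  proof -
    have "t(Suc n := v) \<in> subdivisions a v (Suc n)"
      using that False assms by (intro subdivisions_append) auto
    from ennreal_sum_le_truncated_variation[OF this, of f c]
    show ?thesis unfolding app using that by (simp add: ennreal_plus sum_nonneg)
  qed
  have "ennreal (?V t n) + ennreal (?j v u) \<le> truncated_variation c a v f"
    if t: "t \<in> subdivisions a u n" for t n
  proof (cases "t n = u")
    case False
    then have "t n < u" using t by (auto simp: subdivisions_def)
    then have "t(Suc n := u) \<in> subdivisions a u (Suc n)"
      using t by (intro subdivisions_append) auto
    from at_u[OF this] have "ennreal (?V t n + ?j u (t n)) + ennreal (?j v u) \<le> truncated_variation c a v f"
      unfolding app by simp
    \<comment> \<open>Inserting \<open>u\<close> as a new last point adds a nonnegative term, so it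
      loses nothing.\<close>
    moreover have "ennreal (?V t n) \<le> ennreal (?V t n + ?j u (t n))"
      by (intro ennreal_leI) auto
    ultimately show ?thesis by (meson add_right_mono order_trans)
  qed (use at_u t in auto)
  then have le_minus: "truncated_variation c a u f \<le> truncated_variation c a v f - ennreal (?j v u)"
    unfolding truncated_variation_def[of c a u] by (intro SUP_least) (simp add: ennreal_le_minus_iff)
  \<comment> \<open>Subtraction in \<open>ennreal\<close> is cut off at 0, so undoing it in
    \<open>le_minus\<close> requires that the subtracted jump not exceed the minuend. The one-point
    subdivision at \<open>u\<close>, prolonged by \<open>v\<close>, shows this.\<close>
  have "(\<lambda>_. u) \<in> subdivisions a u 0"
    using assms by (auto simp: subdivisions_def intro: strict_mono_onI)
  from at_u[OF this] have "ennreal (?j v u) \<le> truncated_variation c a v f"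
    by simp
  with le_minus show ?thesis
    by (auto simp: ennreal_le_minus_iff)
qed

lemma truncated_variation_mono_right:
  assumes "u \<le> v"
  shows "truncated_variation c a u f \<le> truncated_variation c a v f"
  unfolding truncated_variation_def using assms
  by (intro SUP_mono' SUP_subset_mono) (auto simp: subdivisions_def)

section \<open>One-sided limits of monotone functions\<close>

lemma mono_on_has_left_limit:
  fixes h :: "real \<Rightarrow> real"
  assumes mono: "mono_on {a..b} h" and t: "t \<in> {a<..b}"
  shows "\<exists>l. (h \<longlongrightarrow> l) (at_left t)"
proof -
  have "at t within ({..<t} \<inter> {a..b}) = at_left t"
    using t by (intro at_within_nhd[of _ "{a<..}"]) auto
  moreover have "(h \<longlongrightarrow> Sup (h ` ({..<t} \<inter> {a..b}))) (at t within ({..<t} \<inter> {a..b}))"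
    using t by (intro Lim_left_bound[where K = "h b"] mono_onD[OF mono]) auto
  ultimately show ?thesis by auto
qed

text \<open>For monotone \<open>T\<close> this is the right limit T(t+), written as an infimum so
  that it is defined before any limit is known to exist.\<close>

definition right_regularization :: "(real \<Rightarrow> real) \<Rightarrow> real \<Rightarrow> real" where
  "right_regularization T t = Inf (T ` {t<..})"

lemma right_regularization_tendsto:
  assumes "mono T"
  shows "(T \<longlongrightarrow> right_regularization T t) (at_right t)"
  using Lim_right_bound[of UNIV t T "T t"] assms
  by (simp add: right_regularization_def monoD)

lemma right_regularization_le:
  assumes "mono T" and "t < u"
  shows "right_regularization T t \<le> T u"
  unfolding right_regularization_def using assms
  by (intro cINF_lower bdd_belowI2[where m = "T t"]) (auto simp: monoD)

lemma le_right_regularization: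
  assumes "mono T"
  shows "T t \<le> right_regularization T t"
  unfolding right_regularization_def using assms
  by (intro cINF_greatest) (auto simp: monoD)

lemma right_regularization_right_continuous:
  assumes "mono T"
  shows "(right_regularization T \<longlongrightarrow> right_regularization T t) (at_right t)"
proof (rule order_tendstoI)
  fix y assume y: "y < right_regularization T t"
  have "y < right_regularization T u" if "t < u" for u
    using y right_regularization_le[OF assms that] le_right_regularization[OF assms, of u] by linarith
  then show "eventually (\<lambda>u. y < right_regularization T u) (at_right t)"
    by (auto simp: eventually_at_filter)
next
  fix y assume "right_regularization T t < y"
  then have "eventually (\<lambda>u. T u < y) (at_right t)"
    using right_regularization_tendsto[OF assms] order_tendstoD(2) by blast
  then obtain v where v: "t < v" "\<And>u. t < u \<Longrightarrow> u < v \<Longrightarrow> T u < y"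
    by (auto simp: eventually_at_right_field)
  \<comment> \<open>The regularization at \<open>u\<close> is bounded by values of \<open>T\<close>
    strictly to the right of \<open>u\<close>; the midpoint supplies one that is still left of
    \<open>v\<close>.\<close>
  have "right_regularization T u < y" if "t < u" "u < v" for u
    using right_regularization_le[OF assms, of u "(u + v) / 2"] v(2)[of "(u + v) / 2"] that by auto
  then show "eventually (\<lambda>u. right_regularization T u < y) (at_right t)"
    using v(1) by (auto simp: eventually_at_right_field)
qed

text \<open>The inequality for \<open>T\<close> is taken at the points s + h and t + h, and h tends
  to 0 from the right. The common shift keeps the two points in order, also when they
  coincide.\<close>

lemma increments_le_right_regularization:
  fixes f :: "real \<Rightarrow> real"
  assumes "mono T" and "s \<le> t"
    and f: "(f \<longlongrightarrow> f s) (at_right s)" "(f \<longlongrightarrow> f t) (at_right t)"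
    and le: "\<And>u v. s \<le> u \<Longrightarrow> u \<le> v \<Longrightarrow> \<bar>f v - f u\<bar> - c \<le> T v - T u"
  shows "\<bar>f t - f s\<bar> - c \<le> right_regularization T t - right_regularization T s"
proof (rule tendsto_le)
  note shift = filterlim_at_right_to_0[THEN iffD1]
  show "((\<lambda>h. T (h + t) - T (h + s)) \<longlongrightarrow> right_regularization T t - right_regularization T s) (at_right 0)"
    using assms(1) by (intro tendsto_diff shift right_regularization_tendsto)
  show "((\<lambda>h. \<bar>f (h + t) - f (h + s)\<bar> - c) \<longlongrightarrow> \<bar>f t - f s\<bar> - c) (at_right 0)"
    by (intro tendsto_intros shift f)
  show "eventually (\<lambda>h. \<bar>f (h + t) - f (h + s)\<bar> - c \<le> T (h + t) - T (h + s)) (at_right 0)"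
    unfolding eventually_at_right_field using \<open>s \<le> t\<close> by (auto intro!: exI[of _ 1] le)
qed simp

section \<open>Functions whose increments are dominated by those of \<open>S\<close>\<close>

lemma total_variation_le_increment:
  assumes lip: "\<And>s t. s \<in> {a..b} \<Longrightarrow> t \<in> {a..b} \<Longrightarrow> s \<le> t \<Longrightarrow> \<bar>g t - g s\<bar> \<le> S t - S s"
  shows "total_variation a b g \<le> ennreal (S b - S a)"
  unfolding total_variation_def
proof (intro SUP_least ennreal_leI)
  fix n t assume t: "t \<in> subdivisions a b n"
  have "(\<Sum>i=1..n. \<bar>g (t i) - g (t (i - 1))\<bar>) \<le> (\<Sum>i=1..n. S (t i) - S (t (i - 1)))"
  proof (rule sum_mono)
    fix i assume i: "i \<in> {1..n}"
    show "\<bar>g (t i) - g (t (i - 1))\<bar> \<le> S (t i) - S (t (i - 1))"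
      using i subdivisions_less[OF t i] by (intro lip subdivisions_bounds[OF t]) auto
  qed
  also have "\<dots> = S (t n) - S (t 0)"
    using sum_telescope''[of 0 n "\<lambda>i. S (t i)"] by simp
  also have "\<dots> \<le> S b - S a"
    using lip[of a "t 0"] lip[of "t n" b] subdivisions_bounds[OF t, of 0] subdivisions_bounds[OF t, of n]
    by auto
  finally show "(\<Sum>i=1..n. \<bar>g (t i) - g (t (i - 1))\<bar>) \<le> S b - S a" .
qed

lemma cadlag_on_if_increments_le:
  assumes lip: "\<And>s t. s \<in> {a..b} \<Longrightarrow> t \<in> {a..b} \<Longrightarrow> s \<le> t \<Longrightarrow> \<bar>g t - g s\<bar> \<le> S t - S s"
    and S: "\<And>t. t \<in> {a..<b} \<Longrightarrow> (S \<longlongrightarrow> S t) (at_right t)"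
  shows "cadlag_on a b g"
  unfolding cadlag_on_def
proof (intro conjI ballI)
  fix t assume t: "t \<in> {a..<b}"
  have "((\<lambda>u. S u - S t) \<longlongrightarrow> 0) (at_right t)"
    using tendsto_diff[OF S[OF t] tendsto_const[of "S t"]] by simp
  moreover have "eventually (\<lambda>u. norm (g u - g t) \<le> S u - S t) (at_right t)"
    unfolding eventually_at_right_field using t by (auto intro!: exI[of _ b] lip)
  ultimately have "((\<lambda>u. g u - g t) \<longlongrightarrow> 0) (at_right t)"
    by (rule Lim_null_comparison[rotated])
  then show "(g \<longlongrightarrow> g t) (at_right t)"
    by (simp add: LIM_zero_iff)
next
  fix t assume t: "t \<in> {a<..b}"
  \<comment> \<open>The domination makes \<open>g + S\<close> nondecreasing, so \<open>g\<close> is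
    a difference of two monotone functions and inherits left limits from them.\<close>
  have "mono_on {a..b} (\<lambda>u. g u + S u)" "mono_on {a..b} S"
    using lip by (fastforce intro!: mono_onI simp: abs_le_iff)+
  then obtain l m where "((\<lambda>u. g u + S u) \<longlongrightarrow> l) (at_left t)" "(S \<longlongrightarrow> m) (at_left t)"
    using mono_on_has_left_limit t by metis
  then have "((\<lambda>u. g u + S u - S u) \<longlongrightarrow> l - m) (at_left t)"
    by (rule tendsto_diff)
  then show "\<exists>l. (g \<longlongrightarrow> l) (at_left t)"
    by auto
qed

text \<open>A McShane extension: the hypothesis and the triangle inequality for
  \<open>\<bar>S t - S s\<bar>\<close> suffice, so the index set needs no order or topology. The
  index s = t in the supremum gives the lower end of the interval at \<open>t\<close>; the
  hypothesis gives the upper end.\<close>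

lemma lipschitz_selection:
  fixes f S :: "'a \<Rightarrow> real"
  assumes le: "\<And>s t. s \<in> I \<Longrightarrow> t \<in> I \<Longrightarrow> \<bar>f t - f s\<bar> - c \<le> \<bar>S t - S s\<bar>"
  obtains g where "\<And>t. t \<in> I \<Longrightarrow> \<bar>g t - f t\<bar> \<le> c / 2"
    and "\<And>s t. s \<in> I \<Longrightarrow> t \<in> I \<Longrightarrow> \<bar>g t - g s\<bar> \<le> \<bar>S t - S s\<bar>"
proof
  define g where "g t = (SUP s\<in>I. f s - c / 2 - \<bar>S t - S s\<bar>)" for t
  have ub: "f s - c / 2 - \<bar>S t - S s\<bar> \<le> f t + c / 2" if "s \<in> I" "t \<in> I" for s t
    using le[OF that] by linarith
  have bdd: "bdd_above ((\<lambda>s. f s - c / 2 - \<bar>S t - S s\<bar>) ` I)" if "t \<in> I" for t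
    using ub that by (intro bdd_aboveI2)
  show "\<bar>g t - f t\<bar> \<le> c / 2" if t: "t \<in> I" for t
  proof -
    have "f t - c / 2 - \<bar>S t - S t\<bar> \<le> g t"
      unfolding g_def by (rule cSUP_upper[OF t bdd[OF t]])
    moreover have "g t \<le> f t + c / 2"
      unfolding g_def using t ub by (intro cSUP_least) auto
    ultimately show ?thesis by linarith
  qed
  have one_sided: "g s \<le> g t + \<bar>S t - S s\<bar>" if "s \<in> I" "t \<in> I" for s t
    unfolding g_def[of s]
  proof (rule cSUP_least)
    fix r assume r: "r \<in> I"
    have "f r - c / 2 - \<bar>S t - S r\<bar> \<le> g t"
      unfolding g_def by (rule cSUP_upper[OF r bdd[OF that(2)]])
    then show "f r - c / 2 - \<bar>S s - S r\<bar> \<le> g t + \<bar>S t - S s\<bar>"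
      by linarith
  qed (use that in auto)
  show "\<bar>g t - g s\<bar> \<le> \<bar>S t - S s\<bar>" if "s \<in> I" "t \<in> I" for s t
    using one_sided[OF that] one_sided[OF that(2,1)] by linarith
qed

section \<open>The minimizer when the truncated variation is finite\<close>

lemma exists_cadlag_minimizer:
  fixes f :: "real \<Rightarrow> real"
  assumes "a \<le> b" and f: "cadlag_on a b f" and "0 \<le> c"
    and fin: "truncated_variation c a b f \<noteq> top"
  obtains g where "cadlag_on a b g" and "\<And>t. t \<in> {a..b} \<Longrightarrow> \<bar>g t - f t\<bar> \<le> c / 2"
    and "total_variation a b g \<le> truncated_variation c a b f"
proof -
  \<comment> \<open>Freezing \<open>f\<close> and its truncated variation after \<open>b\<close>
    provides right limits at \<open>b\<close>, about which \<open>cadlag_on\<close> says nothing,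
    and lets \<open>S\<close> agree with \<open>T\<close> there.\<close>
  define F where "F t = f (min t b)" for t
  define T where "T t = enn2real (truncated_variation c a (min t b) f)" for t
  define S where "S = right_regularization T"
  \<comment> \<open>Monotonicity in the right endpoint carries finiteness over from
    \<open>b\<close>, so \<open>enn2real\<close> loses no information.\<close>
  have T: "truncated_variation c a (min t b) f = ennreal (T t)" for t
    using truncated_variation_mono_right[of "min t b" b c a f] fin
    by (auto simp: T_def top.not_eq_extremum)
  have T_nonneg: "0 \<le> T t" for t
    by (simp add: T_def)
  have mono: "mono T"
  proof (rule monoI)
    fix u v :: real assume "u \<le> v"
    then have "ennreal (T u) \<le> ennreal (T v)"
      unfolding T[symmetric] by (intro truncated_variation_mono_right) auto
    then show "T u \<le> T v" using T_nonneg by simp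
  qed
  have incr: "\<bar>F v - F u\<bar> - c \<le> T v - T u" if "a \<le> u" "u \<le> v" for u v
  proof -
    have "ennreal (T u) + ennreal (max (\<bar>F v - F u\<bar> - c) 0) \<le> ennreal (T v)"
      unfolding T[symmetric] F_def using that assms
      by (intro truncated_variation_superadditive) auto
    then show ?thesis using T_nonneg by (simp flip: ennreal_plus)
  qed
  have F: "(F \<longlongrightarrow> F t) (at_right t)" if "a \<le> t" for t
  proof (cases "t < b")
    case True
    then have "(f \<longlongrightarrow> f t) (at_right t)"
      using f that by (auto simp: cadlag_on_def)
    moreover have "eventually (\<lambda>u. f u = F u) (at_right t)"
      unfolding eventually_at_right_field using True by (auto simp: F_def intro!: exI[of _ b])
    ultimately have "(F \<longlongrightarrow> f t) (at_right t)"
      by (rule Lim_transform_eventually)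
    then show ?thesis using True by (simp add: F_def)
  next
    case False
    have "eventually (\<lambda>u. F u = F t) (at_right t)"
      using False by (auto simp: F_def eventually_at_filter)
    then show ?thesis by (rule tendsto_eventually)
  qed
  have S_incr: "\<bar>F t - F s\<bar> - c \<le> S t - S s" if "a \<le> s" "s \<le> t" for s t
    unfolding S_def using that
    by (intro increments_le_right_regularization mono F incr) auto
  have S_mono: "S s \<le> S t" if "s \<le> t" for s t
    using right_regularization_le[OF mono, of s t] le_right_regularization[OF mono, of t] that
    by (cases "s = t") (auto simp: S_def)
  have "\<bar>f t - f s\<bar> - c \<le> \<bar>S t - S s\<bar>" if "s \<in> {a..b}" "t \<in> {a..b}" for s t
    using S_incr[of s t] S_incr[of t s] that by (cases "s \<le> t") (auto simp: F_def)
  then obtain g where near: "\<And>t. t \<in> {a..b} \<Longrightarrow> \<bar>g t - f t\<bar> \<le> c / 2"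
    and g: "\<And>s t. s \<in> {a..b} \<Longrightarrow> t \<in> {a..b} \<Longrightarrow> \<bar>g t - g s\<bar> \<le> \<bar>S t - S s\<bar>"
    using lipschitz_selection[of "{a..b}" f c S] by blast
  have lip: "\<bar>g t - g s\<bar> \<le> S t - S s" if "s \<in> {a..b}" "t \<in> {a..b}" "s \<le> t" for s t
    using g[OF that(1,2)] S_mono[OF that(3)] by linarith
  show thesis
  proof (rule that[OF _ near])
    show "cadlag_on a b g"
      using lip right_regularization_right_continuous[OF mono]
      unfolding S_def by (rule cadlag_on_if_increments_le)
    \<comment> \<open>Since \<open>T\<close> is constant from \<open>b\<close> on, regularizing adds
      no jump at \<open>b\<close>; with \<open>S a\<close> nonnegative the bound
      \<open>S b - S a\<close> is at most \<open>T b\<close>.\<close>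
    have "T ` {b<..} = (\<lambda>_. T b) ` {b<..}"
      by (rule image_cong) (simp_all add: T_def)
    then have "S b = T b"
      by (simp add: S_def right_regularization_def)
    moreover have "0 \<le> S a"
      using le_right_regularization[OF mono, of a] T_nonneg[of a] by (simp add: S_def)
    ultimately have le: "ennreal (S b - S a) \<le> truncated_variation c a b f"
      using T[of b] ennreal_leI[of "S b - S a" "T b"] by simp
    have "total_variation a b g \<le> ennreal (S b - S a)"
      using lip by (rule total_variation_le_increment)
    then show "total_variation a b g \<le> truncated_variation c a b f"
      using le by (rule order_trans)
  qed
qed

theorem mainTheorem1:
  fixes a b c :: real and f :: "real \<Rightarrow> real"
  assumes "a < b" and "cadlag_on a b f" and "c > 0"
  shows "(INF g\<in>{g. sup_norm_on a b (\<lambda>t. g t - f t) \<le> ennreal (c / 2)}. total_variation a b g)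
           = truncated_variation c a b f
       \<and> (\<exists>f\<^sub>c. cadlag_on a b f\<^sub>c
             \<and> sup_norm_on a b (\<lambda>t. f\<^sub>c t - f t) \<le> ennreal (c / 2)
             \<and> total_variation a b f\<^sub>c = truncated_variation c a b f)"
proof -
  let ?TV = "truncated_variation c a b f"
  let ?G = "{g. sup_norm_on a b (\<lambda>t. g t - f t) \<le> ennreal (c / 2)}"
  have mem_iff: "g \<in> ?G \<longleftrightarrow> (\<forall>t\<in>{a..b}. \<bar>g t - f t\<bar> \<le> c / 2)" for g
    using assms(3) by (simp add: sup_norm_on_le_iff)
  have lower: "?TV \<le> total_variation a b g" if "g \<in> ?G" for g
    using that assms(3) unfolding mem_iff by (intro truncated_variation_le_total_variation) auto
  obtain f\<^sub>c where fc: "cadlag_on a b f\<^sub>c" "f\<^sub>c \<in> ?G" "total_variation a b f\<^sub>c \<le> ?TV"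
  proof (cases "?TV = top")
    case True
    have "f \<in> ?G" using assms(3) unfolding mem_iff by simp
    with True assms(2) show ?thesis by (intro that[of f]) auto
  next
    case False
    then show ?thesis
      using exists_cadlag_minimizer[of a b f c] assms that unfolding mem_iff by (metis less_imp_le)
  qed
  then have eq: "total_variation a b f\<^sub>c = ?TV"
    using lower by (intro antisym)
  \<comment> \<open>The lower bound holds on all of \<open>?G\<close> and is attained at
    \<open>f\<^sub>c\<close>, so the infimum is a minimum.\<close>
  have "(INF g\<in>?G. total_variation a b g) = ?TV"
    using lower INF_lower[OF fc(2), of "total_variation a b"] eq
    by (intro antisym INF_greatest) auto
  with fc eq show ?thesis by auto
qed

end
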